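(* Let $n\ge 1$ and $0\le d\le n-1$. The maximum of $w(\pi)$ over all $\pi\in S_n$ with exactly $d$ descents is $d(n-1-d)$, and this maximum is attained only by the permutation $1\,2\,\cdots\,(n-d-1)\;n\;(n-1)\,\cdots\,(n-d)$.
   Context: For a word $\sigma$ of distinct positive integers, $\mathrm{des}(\sigma)$ is its number of descents (adjacent positions $i$ with $\sigma_i>\sigma_{i+1}$) and $\mathrm{st}(\sigma)$ is its standardization (replace the $j$-th smallest letter by $j$), a permutation. The weight $w\colon S_n\to\mathbb Z_{\ge0}$ is defined recursively: if $\pi$ is the identity $12\cdots n$ or the decreasing permutation $n(n-1)\cdots1$, then $w(\pi)=0$. Otherwise form the word $\pi(1)\cdots\pi(n)(n+1)$ and write it as $\pi_L\cdot 1\cdot\pi_R$, where $\pi_L$ is the (possibly empty) subword left of the letter $1$ and $\pi_R$ the subword right of $1$ (ending in $n+1$). Decompose $\pi_L=\pi_1\cdots\pi_l$: $\pi_1$ is the prefix of $\pi_L$ ending at its largest letter, $\pi_2$ the prefix of the remaining word ending at its largest letter, and so on. Then $w(\pi)=w(\mathrm{st}(\pi_R))+\mathrm{des}(\pi_R)+\sum_{i=1}^{l}\bigl(w(\mathrm{st}(\pi_i))+\mathrm{des}(\pi_i)\bigr)$. *)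

theory Defs
  imports "HOL-Combinatorics.Multiset_Permutations"
begin

text \<open>
  Words are lists of natural numbers. A permutation in \<open>S_n\<close> is its one-line word,
  i.e. an element of \<^term>\<open>permutations_of_set {1..n::nat}\<close>.
\<close>

definition des :: "nat list \<Rightarrow> nat" where
  "des xs = card {i. Suc i < length xs \<and> xs ! i > xs ! Suc i}"

definition st :: "nat list \<Rightarrow> nat list" where
  "st xs = map (\<lambda>x. card {y \<in> set xs. y \<le> x}) xs"

text \<open>The decomposition \<open>\<pi>\<^sub>L = \<pi>\<^sub>1 \<dots> \<pi>\<^sub>l\<close>: each block ends at the largest letter of what remains.\<close>

function max_blocks :: "nat list \<Rightarrow> nat list list" where
  "max_blocks xs =
     (if xs = [] then []
      else let m = Max (set xs) in
        (takeWhile (\<lambda>x. x \<noteq> m) xs @ [m]) # max_blocks (tl (dropWhile (\<lambda>x. x \<noteq> m) xs)))"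
  by pat_completeness auto
termination
proof (relation "measure length", goal_cases)
  case (2 xs m)
  have "length (dropWhile (\<lambda>x. x \<noteq> m) xs) \<le> length xs" by (rule length_dropWhile_le)
  with 2 show ?case by (cases xs) auto
qed auto

declare max_blocks.simps [simp del]

lemma length_max_blocks_le:
  "b \<in> set (max_blocks xs) \<Longrightarrow> length b \<le> length xs"
proof (induction xs rule: max_blocks.induct)
  case (1 xs)
  show ?case
  proof (cases "xs = []")
    case True
    have "max_blocks xs = []" by (subst max_blocks.simps) (simp add: True)
    with 1(2) show ?thesis by simp
  next
    case False
    define m where "m = Max (set xs)"
    define r where "r = tl (dropWhile (\<lambda>x. x \<noteq> m) xs)"
    have mb: "max_blocks xs = (takeWhile (\<lambda>x. x \<noteq> m) xs @ [m]) # max_blocks r"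
      by (subst max_blocks.simps) (simp add: False Let_def m_def r_def)
    have m: "m \<in> set xs" using False by (simp add: m_def)
    then have "dropWhile (\<lambda>x. x \<noteq> m) xs \<noteq> []" by auto
    moreover have "length (takeWhile (\<lambda>x. x \<noteq> m) xs) + length (dropWhile (\<lambda>x. x \<noteq> m) xs) = length xs"
      by (metis length_append takeWhile_dropWhile_id)
    ultimately have len: "Suc (length (takeWhile (\<lambda>x. x \<noteq> m) xs) + length r) = length xs"
      unfolding r_def by (cases "dropWhile (\<lambda>x. x \<noteq> m) xs") auto
    have "b = takeWhile (\<lambda>x. x \<noteq> m) xs @ [m] \<or> b \<in> set (max_blocks r)"
      using 1(2) mb by simp
    then show ?thesis
    proof
      assume "b = takeWhile (\<lambda>x. x \<noteq> m) xs @ [m]"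
      then show ?thesis using len by simp
    next
      assume "b \<in> set (max_blocks r)"
      then have "length b \<le> length r"
        using 1(1)[OF False m_def] unfolding r_def by blast
      then show ?thesis using len by simp
    qed
  qed
qed

lemma length_st [simp]: "length (st xs) = length xs"
  by (simp add: st_def)

text \<open>
  \<open>w\<close> is only meaningful on permutations; all other lists are given the value \<open>0\<close>.
  The recursion need not decrease the length: if \<open>\<pi>\<^sub>L\<close> is empty, then \<open>\<pi>\<^sub>R\<close> is as long as
  \<open>\<pi>\<close>. In that case the first index at which the word differs from the identity decreases.
\<close>

function weight :: "nat list \<Rightarrow> nat" where
  "weight p =
     (let n = length p in
      if p \<notin> permutations_of_set {1..n} then 0
      else if p = [1..<Suc n] \<or> p = rev [1..<Suc n] then 0
      else
        let q = p @ [Suc n];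
            L = takeWhile (\<lambda>x. x \<noteq> 1) q;
            R = tl (dropWhile (\<lambda>x. x \<noteq> 1) q)
        in weight (st R) + des R + (\<Sum>b\<leftarrow>max_blocks L. weight (st b) + des b))"
  by pat_completeness auto
termination
proof (relation "measures [length, \<lambda>p. LEAST i. p ! i \<noteq> Suc i]", goal_cases)
  case 1
  show ?case by simp
next
  case (2 p n q L R)
  have perm: "set p = {1..n}" "distinct p"
    using 2(2) by (auto simp: permutations_of_set_def)
  have ne: "p \<noteq> [1..<Suc n]" using 2(3) by blast
  have n: "length p = n" using 2(1) by simp
  have "n \<noteq> 0" using ne n by auto
  then have "1 \<in> set p" using perm by auto
  then have "dropWhile (\<lambda>x. x \<noteq> 1) q \<noteq> []" using 2(4) by auto
  moreover have "length L + length (dropWhile (\<lambda>x. x \<noteq> 1) q) = Suc n"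
    unfolding 2(5) using n 2(4) by (metis length_append length_append_singleton takeWhile_dropWhile_id)
  ultimately have len: "length L + length R = n"
    unfolding 2(6) by (cases "dropWhile (\<lambda>x. x \<noteq> 1) q") auto
  show ?case
  proof (cases "L = []")
    case False
    then have "length R < n" using len by (cases L) auto
    then show ?thesis using n by simp
  next
    case True
    obtain a p' where p: "p = a # p'" using n \<open>n \<noteq> 0\<close> by (cases p) auto
    have "a = 1" using True p 2(4,5) by (auto split: if_splits)
    with p have p: "p = 1 # p'" by simp
    then have R: "R = p' @ [Suc n]" using 2(4,6) by simp
    have "set p' = set p - {1}" using p perm(2) by simp
    also have "\<dots> = {2..n}" unfolding perm(1) by auto
    finally have "set R = insert (Suc n) {2..n}" unfolding R by simp
    also have "\<dots> = {2..Suc n}" using \<open>n \<noteq> 0\<close> by auto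
    finally have setR: "set R = {2..Suc n}" .
    have "card {y \<in> {2..Suc n}. y \<le> x} = x - 1" if "x \<in> set R" for x
    proof -
      have "{y \<in> {2..Suc n}. y \<le> x} = {2..x}" using that setR by auto
      then show ?thesis by simp
    qed
    then have stR: "st R = map (\<lambda>x. x - 1) R"
      unfolding st_def by (intro map_cong refl) (simp only: setR)
    define k where "k = (LEAST i. p ! i \<noteq> Suc i)"
    have "\<exists>i<n. p ! i \<noteq> Suc i"
    proof (rule ccontr)
      assume "\<not> ?thesis"
      then have "p = [1..<Suc n]" using n by (intro nth_equalityI) (auto simp del: upt_Suc)
      with ne show False by contradiction
    qed
    then obtain i where i: "i < n" "p ! i \<noteq> Suc i" by blast
    have k: "p ! k \<noteq> Suc k" unfolding k_def using i(2) by (rule LeastI)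
    have "k \<le> i" unfolding k_def using i(2) by (rule Least_le)
    then have kn: "k < n" using i(1) by simp
    have "k \<noteq> 0" using k p by (intro notI) simp
    then obtain j where j: "k = Suc j" using not0_implies_Suc by blast
    have lp': "length p' = n - 1" using n p by simp
    have jl: "j < length p'" using kn j lp' by simp
    have "st R ! j = p ! k - 1" using stR R jl p j by (simp add: nth_append)
    moreover have "p ! k \<in> set p" using kn n by simp
    then have "p ! k \<ge> 1" using perm by simp
    ultimately have "st R ! j \<noteq> Suc j" using k j by linarith
    then have "(LEAST i. st R ! i \<noteq> Suc i) \<le> j" by (rule Least_le)
    then show ?thesis using len n True j by (simp add: k_def)
  qed
next
  case (3 p n q L R b)
  have n: "length p = n" using 3(1) by simp
  have perm: "set p = {1..n}" "distinct p"
    using 3(2) by (auto simp: permutations_of_set_def)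
  have "p \<noteq> [1..<Suc n]" using 3(3) by blast
  then have "n \<noteq> 0" using n by auto
  then have "1 \<in> set p" using perm by auto
  then have L: "L = takeWhile (\<lambda>x. x \<noteq> 1) p" using 3(4,5) by simp
  have "dropWhile (\<lambda>x. x \<noteq> 1) p \<noteq> []" using \<open>1 \<in> set p\<close> by auto
  moreover have "length L + length (dropWhile (\<lambda>x. x \<noteq> 1) p) = n"
    unfolding L using n by (metis length_append takeWhile_dropWhile_id)
  ultimately have "length L < n" by (cases "dropWhile (\<lambda>x. x \<noteq> 1) p") auto
  moreover have "length b \<le> length L"
    using 3(7) by (rule length_max_blocks_le)
  ultimately show ?case using n by simp
qed

declare weight.simps [simp del]

end

theory Submission
  imports Defs
begin

text \<open>
  For \<open>p = ys @ zs\<close>, where \<open>zs\<close> is increasing and its letters exceed those of the nonempty word \<open>ys\<close>,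
  the weight of \<open>p\<close> is at most \<open>des ys * asc ys\<close>. A bound in terms of all ascents of \<open>p\<close> would not
  pass through the recursion: if \<open>p\<close> starts with \<open>1\<close>, then \<open>\<pi>\<^sub>R\<close> has as many ascents as \<open>p\<close> and the
  recursion adds \<open>des \<pi>\<^sub>R\<close>. But the maximal letter appended to \<open>p\<close> lengthens \<open>zs\<close>, so the removal of
  \<open>1\<close> costs \<open>ys\<close> one ascent. Likewise each block of \<open>\<pi>\<^sub>L\<close> ends at its maximum, which serves as \<open>zs\<close>
  and pays for the extra descents. The product is superadditive along \<open>\<pi>\<^sub>L \<cdot> 1 \<cdot> \<pi>\<^sub>R\<close>, and
  strictly so if \<open>\<pi>\<^sub>L\<close> is nonempty and \<open>ys\<close> is not decreasing. Hence equality forces \<open>ys\<close> to start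
  with its least letter until what remains of it is decreasing.
\<close>

section \<open>Descents and ascents\<close>

lemma des_Nil [simp]: "des [] = 0"
  by (simp add: des_def)

lemma des_singleton [simp]: "des [x] = 0"
  by (simp add: des_def)

lemma des_Cons_Cons [simp]: "des (x # y # xs) = of_bool (x > y) + des (y # xs)"
proof -
  let ?A = "\<lambda>zs. {i. Suc i < length zs \<and> (zs :: nat list) ! i > zs ! Suc i}"
  have "?A (x # y # xs) = (if x > y then {0} else {}) \<union> Suc ` ?A (y # xs)"
  proof (rule set_eqI)
    fix i show "i \<in> ?A (x # y # xs) \<longleftrightarrow> i \<in> (if x > y then {0} else {}) \<union> Suc ` ?A (y # xs)"
      by (cases i) auto
  qed
  moreover have "finite (?A (y # xs))" by (rule finite_subset[of _ "{..<length (y # xs)}"]) auto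
  ultimately show ?thesis
    unfolding des_def by (auto simp: card_image card_insert_if)
qed

text \<open>Given by recursion rather than as a cardinality: its induction rule follows adjacent
  pairs and also drives the inductions about \<open>des\<close>.\<close>

fun asc :: "nat list \<Rightarrow> nat" where
  "asc (x # y # xs) = of_bool (x < y) + asc (y # xs)"
| "asc _ = 0"

lemma des_append:
  "xs \<noteq> [] \<Longrightarrow> ys \<noteq> [] \<Longrightarrow> des (xs @ ys) = des xs + of_bool (last xs > hd ys) + des ys"
proof (induction xs rule: asc.induct)
  case ("2_2" x)
  then show ?case by (cases ys) auto
qed auto

lemma asc_append:
  "xs \<noteq> [] \<Longrightarrow> ys \<noteq> [] \<Longrightarrow> asc (xs @ ys) = asc xs + of_bool (last xs < hd ys) + asc ys"
proof (induction xs rule: asc.induct)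
  case ("2_2" x)
  then show ?case by (cases ys) auto
qed auto

lemma asc_plus_des: "distinct xs \<Longrightarrow> asc xs + des xs = length xs - 1"
  by (induction xs rule: asc.induct) auto

lemma des_eq_0_iff: "des xs = 0 \<longleftrightarrow> sorted xs"
  by (induction xs rule: asc.induct) fastforce+

lemma asc_eq_0_iff: "asc xs = 0 \<longleftrightarrow> sorted (rev xs)"
proof -
  have "asc xs = 0 \<longleftrightarrow> sorted_wrt (\<ge>) xs"
    by (induction xs rule: asc.induct) (auto intro: order_trans)
  then show ?thesis by (simp add: sorted_wrt_rev)
qed

lemma des_map: "strict_mono_on (set xs) f \<Longrightarrow> des (map f xs) = des xs"
proof (induction xs rule: asc.induct)
  case (1 x y xs)
  have "strict_mono_on (set (y # xs)) f"
    using 1(2) by (rule monotone_on_subset) auto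
  moreover have "f x > f y \<longleftrightarrow> x > y"
    using strict_mono_on_less[OF 1(2), of y x] by simp
  ultimately show ?case using 1(1) by simp
qed auto

lemma asc_map: "strict_mono_on (set xs) f \<Longrightarrow> asc (map f xs) = asc xs"
proof (induction xs rule: asc.induct)
  case (1 x y xs)
  have "strict_mono_on (set (y # xs)) f"
    using 1(2) by (rule monotone_on_subset) auto
  moreover have "f x < f y \<longleftrightarrow> x < y"
    using strict_mono_on_less[OF 1(2), of x y] by simp
  ultimately show ?case using 1(1) by simp
qed auto

section \<open>Standardization\<close>

lemma sorted_map_iff:
  fixes f :: "nat \<Rightarrow> nat"
  shows "strict_mono_on (set xs) f \<Longrightarrow> sorted (map f xs) \<longleftrightarrow> sorted xs"
  by (metis des_map des_eq_0_iff)

text \<open>The relabelling inside \<open>st\<close>, named so that \<open>st xs\<close> is the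
  image of \<open>xs\<close> under a strictly increasing map; descents, ascents and shape then
  transfer through the map lemmas.\<close>

definition rank :: "nat list \<Rightarrow> nat \<Rightarrow> nat" where
  "rank xs x = card {y \<in> set xs. y \<le> x}"

lemma st_eq_map_rank: "st xs = map (rank xs) xs"
  by (simp add: st_def rank_def)

lemma strict_mono_on_rank: "strict_mono_on (set xs) (rank xs)"
proof (rule strict_mono_onI)
  fix x y assume "x \<in> set xs" "y \<in> set xs" "x < y"
  then have "y \<in> {z \<in> set xs. z \<le> y} - {z \<in> set xs. z \<le> x}" by auto
  moreover have "{z \<in> set xs. z \<le> x} \<subseteq> {z \<in> set xs. z \<le> y}" using \<open>x < y\<close> by auto
  ultimately show "rank xs x < rank xs y"
    unfolding rank_def by (intro psubset_card_mono) auto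
qed

lemma st_in_permutations:
  assumes "distinct xs"
  shows "st xs \<in> permutations_of_set {1..length xs}"
proof -
  have inj: "inj_on (rank xs) (set xs)"
    using strict_mono_on_rank by (rule strict_mono_on_imp_inj_on)
  have "rank xs x \<in> {1..length xs}" if "x \<in> set xs" for x
  proof -
    have "{y \<in> set xs. y \<le> x} \<noteq> {}" using that by auto
    then have "rank xs x > 0" unfolding rank_def by (simp add: card_gt_0_iff)
    moreover have "rank xs x \<le> card (set xs)"
      unfolding rank_def by (rule card_mono) auto
    ultimately show ?thesis using card_length[of xs] by simp
  qed
  then have "rank xs ` set xs \<subseteq> {1..length xs}" by blast
  moreover have "card (rank xs ` set xs) = length xs"
    using inj assms by (simp add: card_image distinct_card)
  ultimately have "rank xs ` set xs = {1..length xs}"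
    by (intro card_subset_eq) auto
  then show ?thesis
    using inj assms by (auto simp: permutations_of_set_def st_eq_map_rank distinct_map)
qed

section \<open>Vanishing of the weight on monotone words\<close>

lemma sorted_permutation_eq:
  assumes "p \<in> permutations_of_set {1..n}" "sorted p"
  shows "p = [1..<Suc n]"
proof (rule sorted_distinct_set_unique)
  show "set p = set [1..<Suc n]"
    using assms(1) by (simp add: permutations_of_set_def atLeastLessThanSuc_atLeastAtMost del: upt_Suc)
  show "distinct p" using assms(1) by (simp add: permutations_of_set_def)
qed (simp_all add: assms(2) del: upt_Suc)

lemma weight_trivial:
  assumes "p = [1..<Suc (length p)] \<or> p = rev [1..<Suc (length p)]"
  shows "weight p = 0"
  \<comment> \<open>The default for non-permutations is 0 as well, so the outer conditional
    collapses by \<open>if_cancel\<close>.\<close>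
  by (subst weight.simps) (simp only: Let_def assms if_True if_cancel)

lemma weight_sorted:
  assumes "sorted p"
  shows "weight p = 0"
proof (cases "p \<in> permutations_of_set {1..length p}")
  case True
  then have "p = [1..<Suc (length p)]" using assms by (rule sorted_permutation_eq)
  then show ?thesis by (intro weight_trivial disjI1)
next
  case False
  then show ?thesis by (subst weight.simps) (simp only: Let_def not_False_eq_True if_True)
qed

section \<open>Words with a reversed tail\<close>

text \<open>The shape of the equality case. A one-letter \<open>v\<close> gives the increasing
  words, an empty \<open>u\<close> the decreasing ones; the empty word is excluded.\<close>

definition tail_reversed :: "nat list \<Rightarrow> bool" where
  "tail_reversed xs \<longleftrightarrow> (\<exists>u v. xs = u @ rev v \<and> v \<noteq> [] \<and> sorted (u @ v))"

lemma tail_reversed_map: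
  assumes "strict_mono_on (set xs) f"
  shows "tail_reversed (map f xs) \<longleftrightarrow> tail_reversed xs"
proof
  assume "tail_reversed xs"
  then obtain u v where uv: "xs = u @ rev v" "v \<noteq> []" "sorted (u @ v)"
    unfolding tail_reversed_def by blast
  have "sorted (map f (u @ v))"
    using uv assms by (subst sorted_map_iff) auto
  with uv show "tail_reversed (map f xs)"
    unfolding tail_reversed_def
    by (intro exI[of _ "map f u"] exI[of _ "map f v"]) (simp add: rev_map)
next
  assume "tail_reversed (map f xs)"
  then obtain u v where uv: "map f xs = u @ rev v" "v \<noteq> []" "sorted (u @ v)"
    unfolding tail_reversed_def by blast
  then obtain a b where ab: "xs = a @ b" "map f a = u" "map f b = rev v"
    by (auto simp: map_eq_append_conv)
  have v: "v = map f (rev b)" using ab by (metis rev_map rev_rev_ident)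
  have "sorted (map f (a @ rev b))" using uv ab v by simp
  then have "sorted (a @ rev b)"
    using ab assms by (subst (asm) sorted_map_iff) auto
  with ab uv v show "tail_reversed xs"
    unfolding tail_reversed_def by (intro exI[of _ a] exI[of _ "rev b"]) auto
qed

lemma tail_reversed_sorted:
  assumes "sorted xs" "xs \<noteq> []"
  shows "tail_reversed xs"
proof -
  have "xs = butlast xs @ rev [last xs]" "sorted (butlast xs @ [last xs])"
    using assms by auto
  then show ?thesis unfolding tail_reversed_def by blast
qed

lemma tail_reversed_decreasing: "sorted (rev xs) \<Longrightarrow> xs \<noteq> [] \<Longrightarrow> tail_reversed xs"
  unfolding tail_reversed_def by (intro exI[of _ "[]"] exI[of _ "rev xs"]) auto

text \<open>Lets the equality shape pass through the recursion when 1 is the first letter. From left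
  to right, an empty \<open>u\<close> would make the word decreasing and \<open>a\<close> its
  largest letter, so \<open>u\<close> starts with \<open>a\<close>.\<close>

lemma tail_reversed_Cons_least:
  assumes "xs \<noteq> []" "\<forall>x\<in>set xs. a < x"
  shows "tail_reversed (a # xs) \<longleftrightarrow> tail_reversed xs"
proof
  assume "tail_reversed xs"
  then obtain u v where "xs = u @ rev v" "v \<noteq> []" "sorted (u @ v)"
    unfolding tail_reversed_def by blast
  with assms show "tail_reversed (a # xs)"
    unfolding tail_reversed_def
    by (intro exI[of _ "a # u"] exI[of _ v]) (auto intro: less_imp_le)
next
  assume "tail_reversed (a # xs)"
  then obtain u v where uv: "a # xs = u @ rev v" "v \<noteq> []" "sorted (u @ v)"
    unfolding tail_reversed_def by blast
  have "u \<noteq> []"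
  proof
    assume "u = []"
    then have v: "v = rev xs @ [a]" using uv by (metis append_Nil rev.simps(2) rev_rev_ident)
    with uv \<open>u = []\<close> have "\<forall>x\<in>set xs. x \<le> a" by (auto simp: sorted_append)
    with assms show False by (cases xs) auto
  qed
  then obtain u' where "u = a # u'" using uv by (cases u) auto
  with uv show "tail_reversed xs" unfolding tail_reversed_def by auto
qed

text \<open>A nonempty \<open>u\<close> would start with the least letter of the word, so the whole
  word is \<open>rev v\<close>. This excludes the equality shape when letters precede 1 and there is
  an ascent.\<close>

lemma asc_eq_0_if_tail_reversed:
  assumes "tail_reversed xs" "a \<in> set xs" "\<forall>x\<in>set xs. a \<le> x" "hd xs \<noteq> a"
  shows "asc xs = 0"
proof -
  obtain u v where uv: "xs = u @ rev v" "v \<noteq> []" "sorted (u @ v)"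
    using assms unfolding tail_reversed_def by blast
  have "u = []"
  proof (rule ccontr)
    assume "u \<noteq> []"
    then obtain h u' where u: "u = h # u'" by (cases u) auto
    have "h \<le> a" using assms uv u by auto
    moreover have "a \<le> h" using assms uv u by auto
    ultimately show False using assms uv u by simp
  qed
  then show ?thesis using uv by (simp add: asc_eq_0_iff)
qed

section \<open>The decomposition at maximal letters\<close>

lemma max_blocks_Nil: "max_blocks [] = []"
  by (subst max_blocks.simps) simp

lemma max_blocks_unfold:
  assumes "distinct xs" "xs \<noteq> []"
  obtains ys m zs where "xs = ys @ m # zs" "max_blocks xs = (ys @ [m]) # max_blocks zs"
    "\<forall>x\<in>set ys \<union> set zs. x < m"
proof -
  define m where "m = Max (set xs)"
  have "m \<in> set xs" using assms by (simp add: m_def)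
  then obtain ys zs where xs: "xs = ys @ m # zs" "m \<notin> set ys" by (meson split_list_first)
  have tw: "takeWhile (\<lambda>x. x \<noteq> m) xs = ys" "dropWhile (\<lambda>x. x \<noteq> m) xs = m # zs"
    using xs by (auto simp: takeWhile_append takeWhile_eq_all_conv dropWhile_append)
  have "max_blocks xs = (ys @ [m]) # max_blocks zs"
    using assms(2) tw by (subst max_blocks.simps) (simp add: Let_def flip: m_def)
  moreover have "x < m" if "x \<in> set ys \<union> set zs" for x
  proof -
    have "x \<le> m" unfolding m_def using that xs(1) by (intro Max_ge) auto
    moreover have "x \<noteq> m" using that xs assms(1) by auto
    ultimately show ?thesis by simp
  qed
  ultimately show thesis using that xs(1) by blast
qed

lemma max_blocks_memberE:
  assumes "distinct xs" "b \<in> set (max_blocks xs)"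
  obtains ys m where "b = ys @ [m]" "\<forall>x\<in>set ys. x < m" "distinct b"
  using assms
proof (induction "length xs" arbitrary: xs thesis rule: less_induct)
  case less
  have "xs \<noteq> []" using less.prems(3) by (auto simp: max_blocks_Nil)
  with less.prems(2) obtain ys m zs where *: "xs = ys @ m # zs"
    "max_blocks xs = (ys @ [m]) # max_blocks zs" "\<forall>x\<in>set ys \<union> set zs. x < m"
    by (rule max_blocks_unfold)
  show ?case
  proof (cases "b = ys @ [m]")
    case True
    with * less.prems(1,2) show ?thesis by auto
  next
    case False
    with * less.prems have "b \<in> set (max_blocks zs)" "distinct zs" by auto
    moreover have "length zs < length xs" using * by simp
    ultimately show ?thesis using less.hyps less.prems(1) by blast
  qed
qed

text \<open>Superadditivity: a product of sums dominates the sum of the products, and every descent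
  or ascent inside a block is one of the whole word. The induction splits off the first
  block.\<close>

lemma sum_max_blocks_le:
  assumes "distinct xs" "\<And>b. b \<in> set (max_blocks xs) \<Longrightarrow> f b \<le> des b * asc b"
  shows "(\<Sum>b\<leftarrow>max_blocks xs. f b) \<le> des xs * asc xs"
  using assms
proof (induction "length xs" arbitrary: xs rule: less_induct)
  case less
  show ?case
  proof (cases "xs = []")
    case True
    then show ?thesis by (simp add: max_blocks_Nil)
  next
    case False
    with less.prems(1) obtain ys m zs where *: "xs = ys @ m # zs"
      "max_blocks xs = (ys @ [m]) # max_blocks zs" "\<forall>x\<in>set ys \<union> set zs. x < m"
      by (rule max_blocks_unfold)
    have "f (ys @ [m]) \<le> des (ys @ [m]) * asc (ys @ [m])"
      using less.prems(2) * by simp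
    moreover have "(\<Sum>b\<leftarrow>max_blocks zs. f b) \<le> des zs * asc zs"
      using less.prems * by (intro less.hyps) auto
    moreover have "des (ys @ [m]) + des zs \<le> des xs" "asc (ys @ [m]) + asc zs \<le> asc xs"
      using * by (cases "zs = []"; simp add: des_append[of "ys @ [m]" zs, simplified]
          asc_append[of "ys @ [m]" zs, simplified])+
    then have "(des (ys @ [m]) + des zs) * (asc (ys @ [m]) + asc zs) \<le> des xs * asc xs"
      by (rule mult_le_mono)
    ultimately show ?thesis using * by (simp add: algebra_simps)
  qed
qed

section \<open>The bound and the case of equality\<close>

text \<open>The word \<open>zs\<close> takes up the letters appended by the recursion or the final
  maximum of a block; it is empty when the bound is applied to a whole permutation.\<close>

definition top_extension :: "nat list \<Rightarrow> nat list \<Rightarrow> bool" where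
  "top_extension ys zs \<longleftrightarrow>
     ys \<noteq> [] \<and> distinct (ys @ zs) \<and> sorted zs \<and> (\<forall>y\<in>set ys. \<forall>z\<in>set zs. y < z)"

lemma des_top_extension: "top_extension ys zs \<Longrightarrow> des (ys @ zs) = des ys"
proof (cases "zs = []")
  case False
  assume t: "top_extension ys zs"
  then have "ys \<noteq> []" "des zs = 0" by (simp_all add: top_extension_def des_eq_0_iff)
  moreover have "\<not> hd zs < last ys"
    using t False by (metis top_extension_def last_in_set hd_in_set less_asym)
  ultimately show ?thesis using False by (simp add: des_append)
qed simp

lemma top_extension_map:
  assumes "strict_mono_on (set (ys @ zs)) f" "top_extension ys zs"
  shows "top_extension (map f ys) (map f zs)"
proof -
  have "distinct (map f (ys @ zs))"
    using assms strict_mono_on_imp_inj_on[OF assms(1)]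
    by (simp only: distinct_map top_extension_def)
  moreover have "strict_mono_on (set zs) f" using assms(1) by (rule monotone_on_subset) auto
  then have "sorted (map f zs)" using assms(2) by (simp add: sorted_map_iff top_extension_def)
  ultimately show ?thesis
    using assms strict_mono_onD[OF assms(1)] by (auto simp: top_extension_def)
qed

text \<open>All splittings are allowed because the induction hypothesis is used at splittings
  dictated by the outer word. Equality is carried along, since for a word starting with 1 it reduces
  to equality for what remains.\<close>

definition weight_bounded :: "nat list \<Rightarrow> bool" where
  "weight_bounded p \<longleftrightarrow> (\<forall>ys zs. p = ys @ zs \<longrightarrow> top_extension ys zs \<longrightarrow>
     weight p \<le> des ys * asc ys \<and> (weight p = des ys * asc ys \<longleftrightarrow> tail_reversed ys))"

lemma weight_bounded_st:
  assumes "weight_bounded (st (ys @ zs))" "top_extension ys zs"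
  shows "weight (st (ys @ zs)) \<le> des ys * asc ys"
    and "weight (st (ys @ zs)) = des ys * asc ys \<longleftrightarrow> tail_reversed ys"
proof -
  define f where "f = rank (ys @ zs)"
  have f: "strict_mono_on (set (ys @ zs)) f" unfolding f_def by (rule strict_mono_on_rank)
  then have fy: "strict_mono_on (set ys) f" by (rule monotone_on_subset) auto
  have "st (ys @ zs) = map f ys @ map f zs" by (simp add: st_eq_map_rank f_def)
  moreover have "top_extension (map f ys) (map f zs)"
    using f assms(2) by (rule top_extension_map)
  ultimately show "weight (st (ys @ zs)) \<le> des ys * asc ys"
    and "weight (st (ys @ zs)) = des ys * asc ys \<longleftrightarrow> tail_reversed ys"
    using assms(1) des_map[OF fy] asc_map[OF fy] tail_reversed_map[OF fy]
    unfolding weight_bounded_def by metis+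
qed

lemma sorted_st: "sorted (st xs) \<longleftrightarrow> sorted xs"
  unfolding st_eq_map_rank by (rule sorted_map_iff[OF strict_mono_on_rank])

text \<open>The last letter \<open>m\<close> adds one ascent to a nonempty \<open>ys\<close> and no
  descent, so the product grows by \<open>des b\<close>, which pays for the extra summand. A
  one-letter block is treated apart, as \<open>top_extension\<close> requires a nonempty
  \<open>ys\<close>.\<close>

lemma block_bound:
  assumes "b = ys @ [m]" "\<forall>x\<in>set ys. x < m" "distinct b" "weight_bounded (st b)"
  shows "weight (st b) + des b \<le> des b * asc b"
proof (cases "ys = []")
  case True
  then have "sorted b" using assms(1) by simp
  then have "weight (st b) = 0" "des b = 0" by (simp_all add: weight_sorted sorted_st des_eq_0_iff)
  then show ?thesis by simp
next
  case False
  then have t: "top_extension ys [m]" using assms by (auto simp: top_extension_def)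
  have "weight (st b) \<le> des ys * asc ys"
    using weight_bounded_st(1)[OF _ t] assms(1,4) by simp
  moreover have "des b = des ys" using des_top_extension[OF t] assms(1) by simp
  moreover have "asc b = asc ys + 1" using assms False by (simp add: asc_append)
  ultimately show ?thesis by simp
qed

section \<open>The recursion at the letter 1\<close>

lemma weight_unfold:
  assumes "p \<in> permutations_of_set {1..n}" "p \<noteq> [1..<Suc n]" "p \<noteq> rev [1..<Suc n]"
    "p @ [Suc n] = L @ 1 # R" "1 \<notin> set L"
  shows "weight p = weight (st R) + des R + (\<Sum>b\<leftarrow>max_blocks L. weight (st b) + des b)"
proof -
  have n: "length p = n" using assms(1) by (simp add: length_finite_permutations_of_set)
  have "takeWhile (\<lambda>x. x \<noteq> 1) (L @ 1 # R) = L" "dropWhile (\<lambda>x. x \<noteq> 1) (L @ 1 # R) = 1 # R"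
    using assms(5) by (auto simp: takeWhile_append takeWhile_eq_all_conv dropWhile_append)
  then show ?thesis
    using assms(1-4) n by (subst weight.simps) (simp add: Let_def del: upt_Suc)
qed

text \<open>With \<open>ys = L @ 1 # Y\<close>, expanding \<open>des ys * asc ys\<close> covers the
  bounds for \<open>L\<close> and \<open>R\<close> and leaves at least \<open>asc ys\<close> over if
  \<open>L\<close> is nonempty. This surplus decides the equality case.\<close>

lemma weight_bounded_step:
  assumes p: "p \<in> permutations_of_set {1..n}" "p \<noteq> [1..<Suc n]" "p \<noteq> rev [1..<Suc n]"
    and LR: "p @ [Suc n] = L @ 1 # R" "1 \<notin> set L"
    and R: "weight_bounded (st R)"
    and L: "\<And>b. b \<in> set (max_blocks L) \<Longrightarrow> weight_bounded (st b)"
  shows "weight_bounded p"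
  unfolding weight_bounded_def
proof (intro allI impI)
  fix ys zs assume ys: "p = ys @ zs" and t: "top_extension ys zs"
  have set_p: "set p = {1..n}" and dist: "distinct p"
    using p(1) by (auto simp: permutations_of_set_def)
  have "ys \<noteq> []" using t by (simp add: top_extension_def)
  have least: "\<forall>x\<in>set ys. 1 \<le> x" using set_p ys by auto
  \<comment> \<open>The letters of \<open>zs\<close> exceed those of the nonempty \<open>ys\<close>,
    so the least letter lies in \<open>ys\<close>.\<close>
  have "1 \<in> set ys"
  proof (rule ccontr)
    assume "1 \<notin> set ys"
    moreover have "1 \<in> set p" using set_p ys \<open>ys \<noteq> []\<close> by (cases n) auto
    ultimately have "1 \<in> set zs" using ys by simp
    moreover have "hd ys \<in> set ys" using \<open>ys \<noteq> []\<close> by simp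
    ultimately have "hd ys < 1" using t by (auto simp: top_extension_def)
    then show False using least \<open>hd ys \<in> set ys\<close> by auto
  qed
  then obtain L' Y where Y: "ys = L' @ 1 # Y" "1 \<notin> set L'" by (meson split_list_first)
  \<comment> \<open>The splitting at the first 1 is unique, so the appended \<open>Suc n\<close>
    ends up behind \<open>zs\<close>.\<close>
  have "L' @ 1 # (Y @ zs @ [Suc n]) = L @ 1 # R" using LR(1) Y ys by simp
  then have L': "L' = L" "R = Y @ zs @ [Suc n]"
    using Y(2) LR(2) by (auto simp: append_eq_append_conv2 append_eq_Cons_conv Cons_eq_append_conv)
  have ysL: "ys = L @ 1 # Y" using Y L' by simp
  have dL: "distinct L" using dist ys ysL by simp
  have gt1: "\<forall>x\<in>set L \<union> set Y. 1 < x"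
  proof
    fix x assume x: "x \<in> set L \<union> set Y"
    then have "x \<noteq> 1" "1 \<le> x" using dist ys ysL least by auto
    then show "1 < x" by simp
  qed
  define S where "S = (\<Sum>b\<leftarrow>max_blocks L. weight (st b) + des b)"
  have S: "S \<le> des L * asc L"
    unfolding S_def
  proof (rule sum_max_blocks_le[OF dL])
    fix b assume b: "b \<in> set (max_blocks L)"
    with dL obtain c m where "b = c @ [m]" "\<forall>x\<in>set c. x < m" "distinct b"
      by (rule max_blocks_memberE)
    then show "weight (st b) + des b \<le> des b * asc b"
      using L[OF b] by (rule block_bound)
  qed
  have w: "weight p = weight (st R) + des R + S"
    unfolding S_def using p LR by (rule weight_unfold)
  \<comment> \<open>Indicators of the descent into 1 and of the ascent out of 1.\<close>
  define l y where "l = (of_bool (L \<noteq> []) :: nat)" and "y = (of_bool (Y \<noteq> []) :: nat)"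
  have d1: "des (1 # Y) = des Y" and a1: "asc (1 # Y) = y + asc Y"
    using gt1 by (cases Y; simp add: y_def)+
  have d: "des ys = des L + l + des Y" and a: "asc ys = asc L + y + asc Y"
    unfolding ysL using d1 a1 gt1
    by (cases "L = []"; fastforce simp: l_def des_append asc_append dest: last_in_set)+
  \<comment> \<open>For empty \<open>Y\<close> the word \<open>R\<close> is increasing and both
    summands vanish; equality then holds although the empty word is not
    \<open>tail_reversed\<close>, hence the restriction of the equivalence. For nonempty
    \<open>Y\<close>, the ascent \<open>y = 1\<close> pays for \<open>des R = des Y\<close>.\<close>
  have Rb: "weight (st R) + des R \<le> des Y * (asc Y + y) \<and>
    (Y \<noteq> [] \<longrightarrow> (weight (st R) + des R = des Y * (asc Y + y) \<longleftrightarrow> tail_reversed Y))"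
  proof (cases "Y = []")
    case True
    have "set zs \<subseteq> {1..n}" using set_p ys by auto
    then have "\<forall>x\<in>set zs. x \<le> Suc n" by auto
    then have "sorted R" using True L' t by (auto simp: sorted_append top_extension_def)
    then have "weight (st R) = 0" "des R = 0"
      using weight_sorted sorted_st des_eq_0_iff by auto
    then show ?thesis using True by simp
  next
    case False
    have "\<forall>x\<in>set (ys @ zs). x < Suc n" using set_p ys by (metis atLeastAtMost_iff less_Suc_eq_le)
    then have tY: "top_extension Y (zs @ [Suc n])"
      using False t ysL by (auto simp: top_extension_def sorted_append intro: less_imp_le)
    show ?thesis
      using weight_bounded_st[OF _ tY] R L'(2) des_top_extension[OF tY] False
      by (auto simp: y_def)
  qed
  have ub: "des L * asc L + des Y * (asc Y + y) + l * asc ys \<le> des ys * asc ys"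
    unfolding d a by (simp add: algebra_simps)
  then have le: "weight p \<le> des ys * asc ys" using w S Rb by linarith
  have "weight p = des ys * asc ys \<longleftrightarrow> tail_reversed ys"
  \<comment> \<open>Without ascents the surplus \<open>l * asc ys\<close> vanishes; then
    \<open>ys\<close> is decreasing and the bound is 0.\<close>
  proof (cases "asc ys = 0")
    case True
    then have "tail_reversed ys" using \<open>ys \<noteq> []\<close> by (simp add: tail_reversed_decreasing asc_eq_0_iff)
    then show ?thesis using True le by simp
  next
    case asc: False
    show ?thesis
    proof (cases "L = []")
      case True
      \<comment> \<open>Otherwise \<open>ys\<close> would be the single letter 1, which has no
        ascent.\<close>
      then have "Y \<noteq> []" using asc ysL by auto
      have "tail_reversed ys \<longleftrightarrow> tail_reversed Y"
        using tail_reversed_Cons_least[OF \<open>Y \<noteq> []\<close>] gt1 ysL True by simp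
      moreover have "weight p = weight (st R) + des R"
        using w True by (simp add: S_def max_blocks_Nil)
      moreover have "des ys * asc ys = des Y * (asc Y + y)"
        using d a True by (simp add: l_def)
      ultimately show ?thesis using Rb \<open>Y \<noteq> []\<close> by simp
    next
      case False
      \<comment> \<open>The surplus is positive, and a word with an ascent that does not start with
        its least letter lacks the equality shape.\<close>
      then have "weight p < des ys * asc ys"
        using w S Rb ub asc by (simp add: l_def)
      moreover have "hd ys \<noteq> 1" using False ysL gt1 by (cases L) auto
      then have "\<not> tail_reversed ys"
        using asc_eq_0_if_tail_reversed[OF _ \<open>1 \<in> set ys\<close> least] asc by blast
      ultimately show ?thesis by simp
    qed
  qed
  with le show "weight p \<le> des ys * asc ys \<and> (weight p = des ys * asc ys \<longleftrightarrow> tail_reversed ys)"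
    by blast
qed

text \<open>The induction follows the recursion of \<open>weight\<close>, because \<open>R\<close>
  is as long as \<open>p\<close> when \<open>p\<close> starts with 1 and induction on the length
  would not reach it.\<close>

lemma weight_bounded_permutation:
  "p \<in> permutations_of_set {1..length p} \<Longrightarrow> weight_bounded p"
proof (induction p rule: weight.induct)
  case (1 p)
  note p = \<open>p \<in> permutations_of_set {1..length p}\<close>
  have set_p: "set p = {1..length p}" and dist: "distinct p"
    using p by (auto simp: permutations_of_set_def)
  \<comment> \<open>In the first two cases every prefix \<open>ys\<close> is monotone, so its
    product is 0 and it has the equality shape, in accordance with weight 0.\<close>
  consider "p = [1..<Suc (length p)]" | "p = rev [1..<Suc (length p)]"
    | "p \<noteq> [1..<Suc (length p)]" "p \<noteq> rev [1..<Suc (length p)]" by blast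
  then show ?case
  proof cases
    case 1
    then have sorted: "sorted p" by (metis sorted_upt)
    show ?thesis
      unfolding weight_bounded_def
    proof (intro allI impI)
      fix ys zs assume "p = ys @ zs" "top_extension ys zs"
      then have "sorted ys" "ys \<noteq> []" using sorted by (auto simp: sorted_append top_extension_def)
      then have "des ys = 0" "tail_reversed ys"
        by (simp_all add: des_eq_0_iff tail_reversed_sorted)
      then show "weight p \<le> des ys * asc ys \<and> (weight p = des ys * asc ys \<longleftrightarrow> tail_reversed ys)"
        using weight_sorted[OF sorted] by simp
    qed
  next
    case 2
    then have sorted: "sorted (rev p)" by (metis rev_rev_ident sorted_upt)
    have w: "weight p = 0" using 2 by (intro weight_trivial disjI2)
    show ?thesis
      unfolding weight_bounded_def
    proof (intro allI impI)
      fix ys zs assume "p = ys @ zs" "top_extension ys zs"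
      then have "sorted (rev ys)" "ys \<noteq> []"
        using sorted by (auto simp: sorted_append top_extension_def)
      then have "asc ys = 0" "tail_reversed ys"
        by (simp_all add: asc_eq_0_iff tail_reversed_decreasing)
      then show "weight p \<le> des ys * asc ys \<and> (weight p = des ys * asc ys \<longleftrightarrow> tail_reversed ys)"
        using w by simp
    qed
  next
    case 3
    define q where "q = p @ [Suc (length p)]"
    define L where "L = takeWhile (\<lambda>x. x \<noteq> 1) q"
    define R where "R = tl (dropWhile (\<lambda>x. x \<noteq> 1) q)"
    have "p \<noteq> []" using 3 by (intro notI) simp
    then have "1 \<in> {1..length p}" by (simp add: Suc_le_eq)
    then have "1 \<in> set q" unfolding q_def set_p[symmetric] by simp
    then have drop: "dropWhile (\<lambda>x. x \<noteq> 1) q = 1 # R"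
      unfolding R_def using hd_dropWhile[of "\<lambda>x. x \<noteq> 1" q]
      by (metis (mono_tags, lifting) dropWhile_eq_Nil_conv list.collapse)
    have "q = L @ 1 # R" unfolding L_def drop[symmetric] by simp
    then have LR: "p @ [Suc (length p)] = L @ 1 # R" by (simp only: q_def)
    have "1 \<notin> set L" unfolding L_def by (auto dest: set_takeWhileD)
    have "distinct (p @ [Suc (length p)])" using dist set_p by simp
    then have dist': "distinct L" "distinct R" unfolding LR by auto
    \<comment> \<open>The side conditions in the negated form of the premises of
      \<open>weight.induct\<close>.\<close>
    have nontriv: "\<not> p \<notin> permutations_of_set {1..length p}"
      "\<not> (p = [1..<Suc (length p)] \<or> p = rev [1..<Suc (length p)])"
      using p 3 by blast+
    have "weight_bounded (st R)"
      using "1.IH"(1)[OF refl nontriv q_def L_def R_def] st_in_permutations[OF dist'(2)] by simp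
    moreover have "weight_bounded (st b)" if b: "b \<in> set (max_blocks L)" for b
    proof -
      have "distinct b" using dist'(1) b by (rule max_blocks_memberE)
      then show ?thesis
        using "1.IH"(2)[OF refl nontriv q_def L_def R_def b] st_in_permutations by simp
    qed
    ultimately show ?thesis
      using weight_bounded_step[OF p 3 LR \<open>1 \<notin> set L\<close>] by blast
  qed
qed

section \<open>The unique extremal permutation\<close>

lemma tail_reversed_permutation_iff:
  assumes p: "p \<in> permutations_of_set {1..n}" and "1 \<le> n" "d \<le> n - 1"
  shows "tail_reversed p \<and> des p = d \<longleftrightarrow> p = [1..<n - d] @ rev [n - d..<Suc n]"
proof
  assume "tail_reversed p \<and> des p = d"
  then obtain u v where uv: "p = u @ rev v" "v \<noteq> []" "sorted (u @ v)" and d: "des p = d"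
    unfolding tail_reversed_def by blast
  have "u @ v \<in> permutations_of_set {1..n}"
    using p uv by (auto simp: permutations_of_set_def)
  \<comment> \<open>Only the position of the cut between \<open>u\<close> and \<open>v\<close>
    remains free.\<close>
  then have eq: "u @ v = [1..<Suc n]" using uv(3) by (rule sorted_permutation_eq)
  then have dist: "distinct (u @ v)" by (metis distinct_upt)
  have "asc (rev v) = 0" using uv(3) by (simp add: asc_eq_0_iff sorted_append)
  then have dv: "des (rev v) = length v - 1" using asc_plus_des[of "rev v"] dist by simp
  have "des p = des (rev v)"
  proof (cases "u = []")
    case False
    then have "last u \<le> hd (rev v)" "des u = 0"
      using uv(2,3) by (auto simp: sorted_append des_eq_0_iff hd_rev)
    then show ?thesis using uv False by (simp add: des_append)
  qed (simp add: uv)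
  \<comment> \<open>All descents lie in \<open>rev v\<close>, one fewer than its letters, so
    \<open>d\<close> fixes the cut.\<close>
  then have lv: "length v = Suc d" using dv d uv(2) by (cases v) auto
  have "length u + length v = n" using arg_cong[OF eq, of length] by simp
  then have lu: "length u = n - Suc d" using lv by simp
  have "u = take (n - Suc d) [1..<Suc n]" "v = drop (n - Suc d) [1..<Suc n]"
    using eq lu by (metis append_eq_conv_conj)+
  \<comment> \<open>The first letter of \<open>v\<close>; \<open>d \<le> n - 1\<close> keeps the
    truncated subtraction exact.\<close>
  moreover have "1 + (n - Suc d) = n - d" using assms(2,3) by simp
  ultimately have "u = [1..<n - d]" "v = [n - d..<Suc n]"
    by (simp_all add: take_upt drop_upt del: upt_Suc)
  then show "p = [1..<n - d] @ rev [n - d..<Suc n]" using uv by simp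
next
  assume eq: "p = [1..<n - d] @ rev [n - d..<Suc n]"
  have v: "[n - d..<Suc n] \<noteq> []" by simp
  have "[1..<n - d] @ [n - d..<Suc n] = [1..<Suc n]"
    using assms(2,3) upt_add_eq_append[of 1 "n - d" "Suc d"] by (simp del: upt_Suc)
  then have sorted: "sorted ([1..<n - d] @ [n - d..<Suc n])" by (metis sorted_upt)
  then have "tail_reversed p" unfolding tail_reversed_def eq using v by blast
  moreover have "des p = d"
  proof -
    have "asc (rev [n - d..<Suc n]) = 0" by (simp add: asc_eq_0_iff del: upt_Suc)
    then have dv: "des (rev [n - d..<Suc n]) = d"
      using asc_plus_des[of "rev [n - d..<Suc n]"] assms(2,3) by (simp del: upt_Suc)
    show ?thesis
    proof (cases "[1..<n - d] = []")
      case True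
      then show ?thesis unfolding eq using dv by (simp only: append_Nil)
    next
      case False
      have "des [1..<n - d] = 0" by (simp add: des_eq_0_iff)
      moreover have "last [1..<n - d] \<le> hd (rev [n - d..<Suc n])"
        using False assms(2,3) by simp
      ultimately show ?thesis using dv eq v False by (simp add: des_append del: upt_Suc)
    qed
  qed
  ultimately show "tail_reversed p \<and> des p = d" ..
qed

theorem theorem6p6:
  fixes n d :: nat
  assumes "1 \<le> n" and "d \<le> n - 1"
  shows "Max (weight ` {\<pi> \<in> permutations_of_set {1..n}. des \<pi> = d}) = d * (n - 1 - d)
    \<and> {\<pi> \<in> permutations_of_set {1..n}. des \<pi> = d \<and> weight \<pi> = d * (n - 1 - d)}
        = {[1..<n - d] @ rev [n - d..<Suc n]}"
proof -
  let ?A = "{\<pi> \<in> permutations_of_set {1..n}. des \<pi> = d}"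
  let ?m = "[1..<n - d] @ rev [n - d..<Suc n]"
  \<comment> \<open>Here \<open>p\<close> itself serves as \<open>ys\<close> with empty
    \<open>zs\<close>; of its \<open>n - 1\<close> adjacent pairs, \<open>n - 1 - d\<close> are
    ascents.\<close>
  have bound: "weight p \<le> d * (n - 1 - d) \<and> (weight p = d * (n - 1 - d) \<longleftrightarrow> tail_reversed p)"
    if "p \<in> ?A" for p
  proof -
    have p: "set p = {1..n}" "distinct p" "length p = n" "des p = d"
      using that by (auto simp: permutations_of_set_def dest: distinct_card)
    have "top_extension p []" using p assms(1) by (auto simp: top_extension_def)
    moreover have "weight_bounded p" using that p by (intro weight_bounded_permutation) simp
    moreover have "asc p = n - 1 - d" using asc_plus_des[of p] p by simp
    ultimately show ?thesis using p(4) unfolding weight_bounded_def by (metis append_Nil2)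
  qed
  have "{1..<n - d} \<union> {n - d..<Suc n} = {1..n}" using assms by auto
  then have m: "?m \<in> permutations_of_set {1..n}"
    by (auto simp: permutations_of_set_def simp del: upt_Suc)
  \<comment> \<open>This gives both uniqueness and the witness that attains the maximum.\<close>
  have char: "p \<in> ?A \<and> tail_reversed p \<longleftrightarrow> p = ?m" for p
    using tail_reversed_permutation_iff[OF _ assms] m by blast
  have "{\<pi> \<in> permutations_of_set {1..n}. des \<pi> = d \<and> weight \<pi> = d * (n - 1 - d)} = {?m}"
    using bound char by blast
  moreover have "Max (weight ` ?A) = d * (n - 1 - d)"
  proof (rule Max_eqI)
    show "finite (weight ` ?A)" by simp
    show "k \<le> d * (n - 1 - d)" if "k \<in> weight ` ?A" for k using that bound by blast
    show "d * (n - 1 - d) \<in> weight ` ?A" using bound char by (metis (lifting) image_eqI)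
  qed
  ultimately show ?thesis by blast
qed

end
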